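(* Let $r\ge0$ be real, $\ell,q\ge0$ integers, and $\mathcal B=(\mathcal L,\mathcal Q)$ a quadratic factor on $G=\mathbb{F}_p^n$ of complexity $(\ell,q)$ and rank at least $r$. Then the number of $(w_1,w_2,w_3,w_4)\in G^4$ for which the family of vectors $\mathcal L\cup\{Mw_1,Mw_2,Mw_3,Mw_4:M\in\mathcal Q\}$ is not linearly independent is at most $14p^{4n+\ell+4q-r}$.
   Context: $p$ is an odd prime. A linear factor of complexity $\ell\ge1$ is a linearly independent set $\mathcal L=\{r_1,\dots,r_\ell\}\subseteq\mathbb{F}_p^n$ ($\emptyset$ if $\ell=0$); a purely quadratic factor of complexity $q\ge1$ is a set $\mathcal Q=\{M_1,\dots,M_q\}$ of pairwise distinct symmetric $n\times n$ matrices over $\mathbb{F}_p$ ($\emptyset$ if $q=0$), with rank $n$ if $q=0$ and otherwise $\min\{\mathrm{rk}(\sum_i\lambda_iM_i):(\lambda_i)\ne0\}$. A quadratic factor of complexity $(\ell,q)$ is a pair $(\mathcal L,\mathcal Q)$; its rank is the rank of $\mathcal Q$. "Linearly independent" refers to the family (list) of vectors, so repeated or zero vectors count as a dependence. *)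

theory Defs
  imports "HOL-Analysis.Analysis"
begin

text \<open>Linear independence of a family (list) of vectors: repeated or zero
entries count as a dependence.\<close>
definition lin_indep_list :: "('a::field ^ 'n) list \<Rightarrow> bool" where
  "lin_indep_list vs \<longleftrightarrow>
     (\<forall>c :: nat \<Rightarrow> 'a. (\<Sum>i<length vs. c i *s (vs ! i)) = 0 \<longrightarrow> (\<forall>i<length vs. c i = 0))"

text \<open>Linear combination of a list of matrices with coefficients lam.\<close>
definition mat_comb :: "(nat \<Rightarrow> 'a::field) \<Rightarrow> ('a ^ 'n ^ 'n) list \<Rightarrow> 'a ^ 'n ^ 'n" where
  "mat_comb lam Qs = (\<chi> i j. \<Sum>k<length Qs. lam k * (Qs ! k) $ i $ j)"

text \<open>Rank of a purely quadratic factor: n if empty, else the minimal rank of a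
nontrivial linear combination.\<close>
definition qf_rank :: "('a::field ^ 'n ^ 'n) list \<Rightarrow> nat" where
  "qf_rank Qs = (if Qs = [] then CARD('n)
     else Min {rank (mat_comb lam Qs) | lam. \<exists>k<length Qs. lam k \<noteq> 0})"

text \<open>Quadratic factor (L, Q): L linearly independent, Q pairwise distinct
symmetric matrices. Complexity is (length L, length Q).\<close>
definition quadratic_factor :: "('a::field ^ 'n) list \<Rightarrow> ('a ^ 'n ^ 'n) list \<Rightarrow> bool" where
  "quadratic_factor Ls Qs \<longleftrightarrow> lin_indep_list Ls \<and> distinct Qs \<and>
     (\<forall>M \<in> set Qs. transpose M = M)"

end

theory Submission
  imports Defs
begin

(* If the family is dependent although L is independent, some dependence puts a nonzero
   coefficient on a vector M w_j. Collecting coefficients, it reads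
   c.L + Lam_1 w_1 + ... + Lam_4 w_4 = 0 with Lam_j a linear combination of the matrices
   of Q, at least one of them nontrivial and hence of rank at least r. For each of the at
   most p^(l+4q) coefficient vectors c this affine equation has at most p^(4n-r) solutions,
   since the image of (w_1, ..., w_4) |-> sum_j Lam_j w_j has at least p^(rk Lam_j)
   elements. The union bound over c gives the estimate with constant 1. *)

lemma card_fiber_additive:
  assumes "Modules.additive f" and "y \<in> range f"
  shows "card {x. f x = y} = card {x. f x = 0}"
proof -
  obtain x0 where x0: "f x0 = y" using assms(2) by blast
  have "{x. f x = y} = (\<lambda>x. x + x0) ` {x. f x = 0}"
  proof (intro set_eqI iffI)
    fix x assume "x \<in> {x. f x = y}"
    then have "x - x0 \<in> {x. f x = 0}" using x0 by (simp add: additive.diff[OF assms(1)])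
    then show "x \<in> (\<lambda>x. x + x0) ` {x. f x = 0}" by (rule rev_image_eqI) simp
  qed (auto simp: additive.add[OF assms(1)] x0)
  then show ?thesis by (simp add: card_image)
qed

lemma card_fiber_mult_card_range_le:
  fixes f :: "'a::{ab_group_add,finite} \<Rightarrow> 'b::ab_group_add"
  assumes "Modules.additive f"
  shows "card {x. f x = y} * card (range f) \<le> CARD('a)"
proof -
  have "UNIV = (\<Union>z\<in>range f. {x. f x = z})" by auto
  then have "CARD('a) = card (\<Union>z\<in>range f. {x. f x = z})" by simp
  also have "\<dots> = (\<Sum>z\<in>range f. card {x. f x = z})" by (rule card_UN_disjoint) auto
  also have "\<dots> = card (range f) * card {x. f x = 0}" by (simp add: card_fiber_additive[OF assms])
  finally have "CARD('a) = card {x. f x = 0} * card (range f)" by simp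
  moreover have "card {x. f x = y} \<le> card {x. f x = 0}"
  proof (cases "y \<in> range f")
    case False
    then have "{x. f x = y} = {}" by blast
    then show ?thesis by simp
  qed (simp add: card_fiber_additive[OF assms])
  ultimately show ?thesis by simp
qed

lemma independent_rows_right_inverse:
  fixes A :: "'a::field^'n^'m"
  assumes "inj_on (($) A) I" and "vec.independent (($) A ` I)"
  obtains X :: "'a^'m^'n" where "\<And>k. k \<in> I \<Longrightarrow> (A ** X) $ k = axis k 1"
proof
  define g where
    "g = vec.construct (($) A ` I) (\<lambda>b. axis (inv_into I (($) A) b) (1::'a) :: 'a^'m)"
  have g: "Vector_Spaces.linear (*s) (*s) g"
    unfolding g_def by (rule vec.linear_construct[OF assms(2)])
  fix k assume "k \<in> I"
  have "g (A $ k) = axis k 1"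
    using \<open>k \<in> I\<close> assms by (simp add: g_def vec.construct_basis)
  moreover have "(A ** transpose (matrix g)) $ k = matrix g *v (A $ k)"
    by (simp add: vec_eq_iff matrix_matrix_mult_def matrix_vector_mult_def transpose_def mult.commute)
  ultimately show "(A ** transpose (matrix g)) $ k = axis k 1"
    by (simp add: matrix_works[OF g])
qed

(* rank is the row rank, which the library identifies with the dimension of the column space
   only over the reals; a right inverse on independent rows exhibits rank A free coordinates
   of the image. *)
lemma power_rank_le_card_range:
  fixes A :: "'a::{field,finite}^'n^'m"
  shows "CARD('a) ^ rank A \<le> card (range ((*v) A))"
proof -
  obtain B where B: "B \<subseteq> rows A" "vec.independent B" "card B = rank A"
    using vec.basis_exists[of "rows A"] unfolding row_rank_def_gen by metis
  have "rows A = range (($) A)" by (auto simp: rows_def row_def)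
  then obtain I where I: "inj_on (($) A) I" "B = ($) A ` I"
    using B(1) subset_image_inj by metis
  obtain X where X: "\<And>k. k \<in> I \<Longrightarrow> (A ** X) $ k = axis k 1"
    using independent_rows_right_inverse I B(2) by metis
  have "I \<rightarrow>\<^sub>E UNIV \<subseteq> (\<lambda>y. restrict (($) y) I) ` range ((*v) A)"
  proof
    fix t :: "'m \<Rightarrow> 'a" assume t: "t \<in> I \<rightarrow>\<^sub>E UNIV"
    define s :: "'a^'m" where "s = (\<chi> i. if i \<in> I then t i else 0)"
    have "(A *v (X *v s)) $ k = t k" if "k \<in> I" for k
    proof -
      have "(A *v (X *v s)) $ k = ((A ** X) *v s) $ k" by (metis matrix_vector_mul_assoc)
      also have "\<dots> = s $ k"
        using that
        by (simp add: matrix_vector_mult_def X axis_def if_distrib[of "\<lambda>c. c * _"] cong: if_cong)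
      finally show ?thesis using that by (simp add: s_def)
    qed
    then have "restrict (($) (A *v (X *v s))) I = t"
      using t by (auto simp: restrict_def PiE_def extensional_def)
    then show "t \<in> (\<lambda>y. restrict (($) y) I) ` range ((*v) A)" by blast
  qed
  then have "card (I \<rightarrow>\<^sub>E (UNIV :: 'a set))
      \<le> card ((\<lambda>y. restrict (($) y) I) ` range ((*v) A))"
    by (rule card_mono[rotated]) simp
  also have "\<dots> \<le> card (range ((*v) A))"
    by (rule card_image_le) simp
  finally have "card (I \<rightarrow>\<^sub>E (UNIV :: 'a set)) \<le> card (range ((*v) A))" .
  moreover have "card (I \<rightarrow>\<^sub>E (UNIV :: 'a set)) = CARD('a) ^ rank A"
    using I B(3) by (simp add: card_PiE card_image)
  ultimately show ?thesis by simp
qed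

lemma card_solutions_quadruple_mult_le:
  fixes A :: "nat \<Rightarrow> 'a::{field,finite}^'n^'m"
  assumes "j < 4"
  shows "card {(w1, w2, w3, w4). A 0 *v w1 + A 1 *v w2 + A 2 *v w3 + A 3 *v w4 = v}
           * CARD('a) ^ rank (A j) \<le> CARD('a) ^ (4 * CARD('n))"
    (is "card ?S * _ \<le> _")
proof -
  define F :: "('a^'n) \<times> ('a^'n) \<times> ('a^'n) \<times> ('a^'n) \<Rightarrow> 'a^'m"
    where "F = (\<lambda>(w1, w2, w3, w4). A 0 *v w1 + A 1 *v w2 + A 2 *v w3 + A 3 *v w4)"
  have "Modules.additive F"
    by unfold_locales (auto simp: F_def matrix_vector_right_distrib)
  moreover have "?S = {w. F w = v}"
    by (auto simp: F_def)
  moreover have "CARD(('a^'n) \<times> ('a^'n) \<times> ('a^'n) \<times> ('a^'n)) = CARD('a) ^ (4 * CARD('n))"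
    by (simp add: card_prod mult_numeral_left_semiring_numeral numeral_Bit0 flip: power_add)
  ultimately have fiber: "card ?S * card (range F) \<le> CARD('a) ^ (4 * CARD('n))"
    using card_fiber_mult_card_range_le[of F v] by simp
  have "range ((*v) (A j)) \<subseteq> range F"
  proof
    fix y assume "y \<in> range ((*v) (A j))"
    then obtain x where x: "y = A j *v x" by blast
    have "j = 0 \<or> j = 1 \<or> j = 2 \<or> j = 3" using \<open>j < 4\<close> by linarith
    then have "y = F (if j = 0 then x else 0, if j = 1 then x else 0, if j = 2 then x else 0,
                      if j = 3 then x else 0)"
      using x by (elim disjE) (simp_all add: F_def)
    then show "y \<in> range F" by blast
  qed
  then have "card (range ((*v) (A j))) \<le> card (range F)"
    by (rule card_mono[rotated]) simp
  with power_rank_le_card_range have "CARD('a) ^ rank (A j) \<le> card (range F)"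
    by (rule le_trans)
  then have "card ?S * CARD('a) ^ rank (A j) \<le> card ?S * card (range F)"
    by (rule mult_le_mono2)
  also note fiber
  finally show ?thesis .
qed

lemma sum_lessThan_add_nat: "(\<Sum>i<a + b. g i) = (\<Sum>i<a. g i) + (\<Sum>i<b. g (a + i))"
  for a b :: nat
  by (induction b) (simp_all add: add.assoc)

lemma sum_scaled_nth_append:
  fixes xs ys :: "('a::field^'n) list"
  shows "(\<Sum>i<length xs + length ys. c i *s (xs @ ys) ! i) =
    (\<Sum>i<length xs. c i *s xs ! i) + (\<Sum>i<length ys. c (length xs + i) *s ys ! i)"
  by (simp add: sum_lessThan_add_nat nth_append)

lemma mat_comb_mult_vec:
  "mat_comb lam Qs *v w = (\<Sum>k<length Qs. lam k *s (Qs ! k *v w))"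
  by (simp add: vec_eq_iff mat_comb_def matrix_vector_mult_def sum_component
      sum_distrib_left sum_distrib_right mult.assoc sum.swap[of _ UNIV])

lemma length_concat_map_images:
  "length (concat (map (\<lambda>M. map ((*v) M) ws) Qs)) = length Qs * length ws"
  by (induction Qs) auto

lemma sum_scaled_nth_concat_map_images:
  fixes Qs :: "('a::field^'n^'n) list" and ws :: "('a^'n) list"
  defines "Fs \<equiv> concat (map (\<lambda>M. map ((*v) M) ws) Qs)"
  shows "(\<Sum>i<length Fs. c i *s Fs ! i) =
    (\<Sum>j<length ws. mat_comb (\<lambda>k. c (k * length ws + j)) Qs *v ws ! j)"
proof -
  have "(\<Sum>i<length Fs. c i *s Fs ! i) =
    (\<Sum>k<length Qs. \<Sum>j<length ws. c (k * length ws + j) *s (Qs ! k *v ws ! j))"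
    unfolding Fs_def
  proof (induction Qs arbitrary: c)
    case (Cons M Qs)
    then show ?case
      using sum_scaled_nth_append[of c "map ((*v) M) ws"]
      by (simp add: sum.lessThan_Suc_shift add.assoc del: sum.lessThan_Suc)
  qed simp
  then show ?thesis
    by (simp add: mat_comb_mult_vec sum.swap[of _ "{..<length Qs}"])
qed

lemma not_lin_indep_append_tail_coefficient:
  fixes Ls Ms :: "('a::field^'n) list"
  assumes "lin_indep_list Ls" and "\<not> lin_indep_list (Ls @ Ms)"
  obtains c i where "c \<in> {..<length Ls + length Ms} \<rightarrow>\<^sub>E UNIV" and "i < length Ms"
    and "c (length Ls + i) \<noteq> 0"
    and "(\<Sum>i<length Ls. c i *s Ls ! i) + (\<Sum>i<length Ms. c (length Ls + i) *s Ms ! i) = 0"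
proof -
  let ?N = "length Ls + length Ms"
  obtain c0 i0 where rel0: "(\<Sum>i<?N. c0 i *s (Ls @ Ms) ! i) = 0" and "i0 < ?N" "c0 i0 \<noteq> 0"
    using assms(2) unfolding lin_indep_list_def by auto
  define c where "c = restrict c0 {..<?N}"
  have "(\<Sum>i<?N. c i *s (Ls @ Ms) ! i) = 0"
    using rel0 by (simp add: c_def)
  then have rel: "(\<Sum>i<length Ls. c i *s Ls ! i) + (\<Sum>i<length Ms. c (length Ls + i) *s Ms ! i) = 0"
    by (simp only: sum_scaled_nth_append)
  have "\<exists>i<length Ms. c (length Ls + i) \<noteq> 0"
  proof (rule ccontr)
    assume "\<not> (\<exists>i<length Ms. c (length Ls + i) \<noteq> 0)"
    then have tail: "c (length Ls + i) = 0" if "i < length Ms" for i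
      using that by blast
    then have "(\<Sum>i<length Ms. c (length Ls + i) *s Ms ! i) = 0"
      by (intro sum.neutral) simp
    then have "(\<Sum>i<length Ls. c i *s Ls ! i) = 0" using rel by simp
    then have head: "c i = 0" if "i < length Ls" for i
      using assms(1) that unfolding lin_indep_list_def by blast
    have "c i0 = 0"
    proof (cases "i0 < length Ls")
      case False
      then show ?thesis using tail[of "i0 - length Ls"] \<open>i0 < ?N\<close> by simp
    qed (rule head)
    then show False using \<open>i0 < ?N\<close> \<open>c0 i0 \<noteq> 0\<close> by (simp add: c_def)
  qed
  then obtain i where "i < length Ms" "c (length Ls + i) \<noteq> 0" by blast
  moreover have "c \<in> {..<?N} \<rightarrow>\<^sub>E UNIV" by (simp add: c_def)
  ultimately show ?thesis using rel that by blast
qed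

lemma not_lin_indep_family_relation:
  fixes Ls :: "('a::field^'n) list" and Qs :: "('a^'n^'n) list" and ws :: "('a^'n) list"
  assumes "lin_indep_list Ls" and "\<not> lin_indep_list (Ls @ concat (map (\<lambda>M. map ((*v) M) ws) Qs))"
  obtains c k j where "c \<in> {..<length Ls + length Qs * length ws} \<rightarrow>\<^sub>E UNIV"
    and "k < length Qs" and "j < length ws" and "c (length Ls + k * length ws + j) \<noteq> 0"
    and "(\<Sum>i<length Ls. c i *s Ls ! i) +
           (\<Sum>j<length ws. mat_comb (\<lambda>k. c (length Ls + k * length ws + j)) Qs *v ws ! j) = 0"
proof -
  let ?l = "length Ls" and ?m = "length ws" and ?Ms = "concat (map (\<lambda>M. map ((*v) M) ws) Qs)"
  obtain c i where c: "c \<in> {..<?l + length ?Ms} \<rightarrow>\<^sub>E UNIV"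
    and i: "i < length ?Ms" "c (?l + i) \<noteq> 0"
    and rel: "(\<Sum>i<?l. c i *s Ls ! i) + (\<Sum>i<length ?Ms. c (?l + i) *s ?Ms ! i) = 0"
    by (rule not_lin_indep_append_tail_coefficient[OF assms])
  show ?thesis
  proof (rule that)
    show "c \<in> {..<?l + length Qs * ?m} \<rightarrow>\<^sub>E UNIV"
      using c by (simp add: length_concat_map_images)
    show "i div ?m < length Qs" and "i mod ?m < ?m"
      using i(1) by (auto simp: length_concat_map_images less_mult_imp_div_less intro: mod_less_divisor)
    show "c (?l + i div ?m * ?m + i mod ?m) \<noteq> 0"
      using i(2) by (simp add: add.assoc)
    show "(\<Sum>i<?l. c i *s Ls ! i) +
        (\<Sum>j<?m. mat_comb (\<lambda>k. c (?l + k * ?m + j)) Qs *v ws ! j) = 0"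
      using rel by (simp add: sum_scaled_nth_concat_map_images add.assoc)
  qed
qed

lemma qf_rank_le_rank_mat_comb:
  fixes Qs :: "('a::field^'n^'n) list"
  assumes "k < length Qs" and "lam k \<noteq> 0"
  shows "qf_rank Qs \<le> rank (mat_comb lam Qs)"
proof -
  let ?R = "{rank (mat_comb lam Qs) | lam. \<exists>k<length Qs. lam k \<noteq> 0}"
  have "?R \<subseteq> {..CARD('n)}"
    using dim_subset_UNIV_cart_gen by (auto simp: row_rank_def_gen)
  then have "finite ?R" by (rule finite_subset) simp
  moreover have "rank (mat_comb lam Qs) \<in> ?R" using assms by blast
  moreover have "Qs \<noteq> []" using assms(1) by auto
  ultimately show ?thesis by (simp add: qf_rank_def)
qed

lemma card_mult_le_of_cover:
  assumes "A \<subseteq> (\<Union>c\<in>C. Z c)" and "finite C" and "\<And>c. c \<in> C \<Longrightarrow> finite (Z c)"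
    and "\<And>c. c \<in> C \<Longrightarrow> card (Z c) * m \<le> b"
  shows "card A * m \<le> card C * b"
proof -
  have "card A \<le> card (\<Union>c\<in>C. Z c)"
    using assms(1-3) by (intro card_mono) auto
  also have "\<dots> \<le> (\<Sum>c\<in>C. card (Z c))"
    using assms(2) by (rule card_UN_le)
  finally have "card A * m \<le> (\<Sum>c\<in>C. card (Z c)) * m"
    by (rule mult_le_mono1)
  also have "\<dots> = (\<Sum>c\<in>C. card (Z c) * m)"
    by (rule sum_distrib_right)
  also have "\<dots> \<le> (\<Sum>c\<in>C. b)"
    using assms(4) by (rule sum_mono)
  finally show ?thesis by simp
qed

lemma card_solutions_nontrivial_comb_mult_le:
  fixes Qs :: "('a::{field,finite}^'n^'n) list" and c :: "nat \<Rightarrow> 'a"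
  assumes "k < length Qs" and "j < 4" and "c (l + k * 4 + j) \<noteq> 0"
  shows "card {(w1, w2, w3, w4).
           (\<Sum>i<4. mat_comb (\<lambda>k. c (l + k * 4 + i)) Qs *v [w1, w2, w3, w4] ! i) = v}
         * CARD('a) ^ qf_rank Qs \<le> CARD('a) ^ (4 * CARD('n))"
proof -
  define A where "A i = mat_comb (\<lambda>k. c (l + k * 4 + i)) Qs" for i
  let ?S = "{(w1, w2, w3, w4). A 0 *v w1 + A 1 *v w2 + A 2 *v w3 + A 3 *v w4 = v}"
  have set_eq: "{(w1, w2, w3, w4).
      (\<Sum>i<4. mat_comb (\<lambda>k. c (l + k * 4 + i)) Qs *v [w1, w2, w3, w4] ! i) = v} = ?S"
    by (simp add: A_def eval_nat_numeral add.assoc)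
  have "qf_rank Qs \<le> rank (A j)"
    unfolding A_def using assms(1,3) by (rule qf_rank_le_rank_mat_comb)
  then have "card ?S * CARD('a) ^ qf_rank Qs \<le> card ?S * CARD('a) ^ rank (A j)"
    by (simp add: power_increasing)
  also have "\<dots> \<le> CARD('a) ^ (4 * CARD('n))"
    using assms(2) by (rule card_solutions_quadruple_mult_le)
  finally show ?thesis
    unfolding set_eq .
qed

lemma card_dependent_quadruples_mult_le:
  fixes Ls :: "('a::{field,finite}^'n) list" and Qs :: "('a^'n^'n) list"
  assumes "lin_indep_list Ls"
  shows "card {(w1, w2, w3, w4).
           \<not> lin_indep_list (Ls @ concat (map (\<lambda>M. [M *v w1, M *v w2, M *v w3, M *v w4]) Qs))}
         * CARD('a) ^ qf_rank Qs \<le> CARD('a) ^ (4 * CARD('n) + length Ls + 4 * length Qs)"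
    (is "card ?Bad * _ \<le> _")
proof -
  let ?l = "length Ls" and ?q = "length Qs"
  define Z where "Z c = {(w1, w2, w3, w4).
      (\<Sum>j<4. mat_comb (\<lambda>k. c (?l + k * 4 + j)) Qs *v [w1, w2, w3, w4] ! j)
        = - (\<Sum>i<?l. c i *s Ls ! i)}" for c :: "nat \<Rightarrow> 'a"
  define C where "C = {c \<in> {..<?l + ?q * 4} \<rightarrow>\<^sub>E (UNIV :: 'a set).
      \<exists>k<?q. \<exists>j<4. c (?l + k * 4 + j) \<noteq> 0}"
  have "?Bad \<subseteq> (\<Union>c\<in>C. Z c)"
  proof safe
    fix w1 w2 w3 w4 :: "'a^'n"
    assume "\<not> lin_indep_list (Ls @ concat (map (\<lambda>M. [M *v w1, M *v w2, M *v w3, M *v w4]) Qs))"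
    then have dep: "\<not> lin_indep_list (Ls @ concat (map (\<lambda>M. map ((*v) M) [w1, w2, w3, w4]) Qs))"
      by simp
    have len: "length [w1, w2, w3, w4] = 4" by simp
    obtain c k j where "c \<in> {..<?l + ?q * 4} \<rightarrow>\<^sub>E UNIV" "k < ?q" "j < 4"
      "c (?l + k * 4 + j) \<noteq> 0"
      and rel: "(\<Sum>i<?l. c i *s Ls ! i)
        + (\<Sum>j<4. mat_comb (\<lambda>k. c (?l + k * 4 + j)) Qs *v [w1, w2, w3, w4] ! j) = 0"
      by (rule not_lin_indep_family_relation[OF assms dep, unfolded len])
    then have "c \<in> C" by (auto simp: C_def)
    moreover have "(w1, w2, w3, w4) \<in> Z c"
      using rel by (simp add: Z_def eq_neg_iff_add_eq_0 add.commute)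
    ultimately show "(w1, w2, w3, w4) \<in> (\<Union>c\<in>C. Z c)" by blast
  qed
  moreover have C_sub: "C \<subseteq> {..<?l + ?q * 4} \<rightarrow>\<^sub>E UNIV" by (auto simp: C_def)
  moreover have fin: "finite ({..<?l + ?q * 4} \<rightarrow>\<^sub>E (UNIV :: 'a set))"
    by (simp add: finite_PiE)
  moreover have "card (Z c) * CARD('a) ^ qf_rank Qs \<le> CARD('a) ^ (4 * CARD('n))" if "c \<in> C" for c
    using \<open>c \<in> C\<close> unfolding C_def Z_def by (blast intro: card_solutions_nontrivial_comb_mult_le)
  ultimately have "card ?Bad * CARD('a) ^ qf_rank Qs \<le> card C * CARD('a) ^ (4 * CARD('n))"
    by (intro card_mult_le_of_cover) (auto intro: finite_subset)
  also have "\<dots> \<le> CARD('a) ^ (?l + ?q * 4) * CARD('a) ^ (4 * CARD('n))"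
    using card_mono[OF fin C_sub] by (simp add: card_PiE)
  also have "\<dots> = CARD('a) ^ (4 * CARD('n) + ?l + 4 * ?q)"
    by (simp add: ac_simps flip: power_add)
  finally show ?thesis .
qed

lemma real_le_powr_of_mult_power_le:
  fixes N p k e :: nat and r :: real
  assumes "N * p ^ k \<le> p ^ e" and "1 \<le> p" and "r \<le> real k"
  shows "real N \<le> real p powr (real e - r)"
proof -
  have "real N * real p ^ k \<le> real p ^ e"
    using assms(1) by (metis of_nat_le_iff of_nat_mult of_nat_power)
  then have "real N \<le> real p ^ e / real p ^ k"
    using assms(2) by (simp add: pos_le_divide_eq)
  also have "\<dots> = real p powr (real e - real k)"
    using assms(2) by (simp add: powr_diff powr_realpow)
  also have "\<dots> \<le> real p powr (real e - r)"
    using assms(2,3) by (intro powr_mono) auto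
  finally show ?thesis .
qed

theorem mainTheorem7:
  fixes p :: nat and r :: real
    and Ls :: "('a::{field,finite} ^ 'n) list" and Qs :: "('a ^ 'n ^ 'n) list"
  assumes "prime p" and "odd p" and "CARD('a) = p"
    and "r \<ge> 0"
    and "quadratic_factor Ls Qs"
    and "real (qf_rank Qs) \<ge> r"
  shows "real (card {(w1 :: 'a ^ 'n, w2 :: 'a ^ 'n, w3 :: 'a ^ 'n, w4 :: 'a ^ 'n).
            \<not> lin_indep_list (Ls @ concat (map (\<lambda>M. [M *v w1, M *v w2, M *v w3, M *v w4]) Qs))})
         \<le> 14 * real p powr (real (4 * CARD('n) + length Ls + 4 * length Qs) - r)"
proof -
  have "lin_indep_list Ls"
    using assms(5) by (simp add: quadratic_factor_def)
  moreover have "1 \<le> p"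
    using prime_gt_0_nat[OF assms(1)] by simp
  ultimately show ?thesis
    using real_le_powr_of_mult_power_le[OF card_dependent_quadruples_mult_le[of Ls Qs, unfolded assms(3)]
        _ assms(6)]
    by (smt (verit) powr_ge_zero)
qed

end
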